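(* Let $\alpha\ge 1$ and $k\ge 1$ be integers. Then: (1) $U^{k}(\mathbb{Z}_{2^{\alpha}})$ is a boolean ring if and only if $\alpha=2k$ or $\alpha=2k+1$, and it is trivial if and only if $\alpha<2k$. (2) $U^{k}(\mathbb{Z}_{3^{\alpha}})$ is a boolean ring if and only if $\alpha=k$, and it is trivial if and only if $\alpha<k$.
   Context: For an integer $n\ge 1$, $\mathbb{Z}_n$ is the ring of integers modulo $n$ ($\mathbb{Z}_1=\{0\}$). For a finite commutative ring $R$ with identity (the zero ring is allowed, with $U(\{0\})=\{0\}$), $U(R)$ is its group of units. Since $U(R)$ is a finite abelian group, it is isomorphic to a product $\mathbb{Z}_{n_1}\times\cdots\times\mathbb{Z}_{n_i}$ of cyclic groups, and $U(R)$ is regarded as a ring by transporting the ring structure of $\mathbb{Z}_{n_1}\oplus\cdots\oplus\mathbb{Z}_{n_i}$ (up to ring isomorphism this does not depend on the chosen decomposition). The $k$-th (generalized) group of units is defined by $U^0(R)=R$, $U^1(R)=U(R)$ and $U^k(R)=U(U^{k-1}(R))$, where $U^{k-1}(R)$ is viewed as a ring in this way. "Trivial" means having exactly one element. "Boolean ring" means a nontrivial ring in which $x^2=x$ for all $x$ (in the finite case: isomorphic to a direct sum of $r\ge 1$ copies of $\mathbb{Z}_2$). *)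

theory Defs
  imports "HOL-Algebra.Algebra"
begin

(* ZFact is used for the ring of integers mod n because, unlike residue_ring, it is a ring
   also for n = 1 (the zero ring). The empty list yields the one-element ring. *)
definition ZFact_prod :: "nat list \<Rightarrow> int set list ring" where
  "ZFact_prod ns = RDirProd_list (map (\<lambda>n. ZFact (int n)) ns)"

definition cyclic_decomp ::
    "('a, 'b) monoid_scheme \<Rightarrow> nat list \<times> (int set list \<Rightarrow> 'a) \<Rightarrow> bool" where
  "cyclic_decomp G = (\<lambda>(ns, \<phi>). (\<forall>n\<in>set ns. 1 \<le> n) \<and> \<phi> \<in> iso (add_monoid (ZFact_prod ns)) G)"

(* image_ring transports the ring structure along \<phi>: the carrier of the result is Units R,
   its addition on that carrier is the multiplication of R, and its zero is the one of R. The
   decomposition is an arbitrary one; another choice gives an isomorphic ring. *)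
definition units_ring :: "('a, 'b) ring_scheme \<Rightarrow> 'a ring" where
  "units_ring R =
     (case (SOME d. cyclic_decomp (units_of R) d) of (ns, \<phi>) \<Rightarrow> image_ring \<phi> (ZFact_prod ns))"

definition iterated_units :: "nat \<Rightarrow> 'a ring \<Rightarrow> 'a ring" where
  "iterated_units k R = (units_ring ^^ k) R"

definition boolean_ring :: "('a, 'b) ring_scheme \<Rightarrow> bool" where
  "boolean_ring R \<longleftrightarrow>
     ring R \<and> card (carrier R) \<noteq> 1 \<and> (\<forall>x\<in>carrier R. x [^]\<^bsub>R\<^esub> (2::nat) = x)"

definition trivial_ring :: "('a, 'b) ring_scheme \<Rightarrow> bool" where
  "trivial_ring R \<longleftrightarrow> card (carrier R) = 1"

end

theory Submission
  imports Defs "HOL-Number_Theory.Residue_Primitive_Roots"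
begin

text \<open>
  The unit groups are \<open>U(\<int>\<^bsub>2^a\<^esub>) \<cong> \<int>\<^sub>2 \<times> \<int>\<^bsub>2^(a-2)\<^esub>\<close> for a at least 2 and
  \<open>U(\<int>\<^bsub>3^a\<^esub>) \<cong> \<int>\<^sub>2 \<times> \<int>\<^bsub>3^(a-1)\<^esub>\<close> for a at least 1. The factor \<open>\<int>\<^sub>2\<close> has a trivial unit group, so
  for \<open>k \<ge> 2\<close> the k-th unit group of \<open>\<int>\<^bsub>2^a\<^esub>\<close> is the (k-1)-st one of \<open>\<int>\<^bsub>2^(a-2)\<^esub>\<close>, and that of \<open>\<int>\<^bsub>3^a\<^esub>\<close> is
  the (k-1)-st one of \<open>\<int>\<^bsub>3^(a-1)\<^esub>\<close>. Everything reduces to k = 1, where U is trivial if its order, the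
  totient, is 1, and Boolean if it is nontrivial of exponent 2.

  No isomorphism between the successive rings is constructed. For a finite abelian group only two numbers
  are recorded, its order and its exponent. For the additive group of a product of residue rings
  \<open>\<int>\<^sub>n\<close> these are the product and the least common multiple of the moduli n; for its unit group they
  are the product of the totients and the least common multiple of the values of Carmichael's
  function (lemma \<open>ring_type_ZFact_prod\<close>). The ring U(R) has such a form for unknown moduli whose
  product and least common multiple are the order and exponent of the unit group of R
  (\<open>units_ring_type\<close>). If these two numbers are those of \<open>\<int>\<^sub>2 \<times> \<int>\<^bsub>p^b\<^esub>\<close>, they force the order and exponent
  of the next unit group to be those of \<open>U(\<int>\<^bsub>p^b\<^esub>)\<close>, whichever moduli were chosen
  (\<open>totient_Carmichael_prime_power_of_factors\<close>). That a decomposition exists at all is shown directly for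
  groups with these two numbers (\<open>cyclic_decomp_two_times_prime_power\<close>).
\<close>

section \<open>Order and exponent of abelian groups\<close>

text \<open>The number c is the exponent of G: it is described by the set of its multiples, because that
  description passes through isomorphisms and products by pure logic.\<close>
definition order_exponent :: "('a, 'b) monoid_scheme \<Rightarrow> nat \<Rightarrow> nat \<Rightarrow> bool" where
  "order_exponent G t c \<longleftrightarrow> comm_group G \<and> order G = t \<and>
     (\<forall>d::nat. (\<forall>x\<in>carrier G. x [^]\<^bsub>G\<^esub> d = \<one>\<^bsub>G\<^esub>) \<longleftrightarrow> c dvd d)"

lemma iso_pow_eq_one_iff:
  assumes "group G" "group H" "\<phi> \<in> iso G H"
  shows "(\<forall>x\<in>carrier G. x [^]\<^bsub>G\<^esub> (d::nat) = \<one>\<^bsub>G\<^esub>) \<longleftrightarrow> (\<forall>y\<in>carrier H. y [^]\<^bsub>H\<^esub> d = \<one>\<^bsub>H\<^esub>)"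
proof -
  interpret G: group G by fact
  interpret H: group H by fact
  interpret \<phi>: group_hom G H \<phi>
    using assms by unfold_locales (auto simp: iso_def)
  have im: "\<phi> ` carrier G = carrier H" and inj: "inj_on \<phi> (carrier G)"
    using assms(3) by (auto simp: iso_def bij_betw_def)
  have "\<phi> x [^]\<^bsub>H\<^esub> d = \<one>\<^bsub>H\<^esub> \<longleftrightarrow> x [^]\<^bsub>G\<^esub> d = \<one>\<^bsub>G\<^esub>" if "x \<in> carrier G" for x
    using inj_onD[OF inj, of "x [^]\<^bsub>G\<^esub> d" "\<one>\<^bsub>G\<^esub>"] that by (auto simp flip: \<phi>.hom_nat_pow)
  thus ?thesis
    by (auto simp flip: im)
qed

lemma order_exponent_iso:
  assumes "\<phi> \<in> iso G H" "comm_group G" "group H"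
  shows "order_exponent G t c \<longleftrightarrow> order_exponent H t c"
proof -
  have "comm_group H"
    using comm_group.iso_imp_comm_group[OF assms(2), of H] assms
    by (auto simp: is_iso_def group.is_monoid)
  thus ?thesis
    using iso_pow_eq_one_iff[OF comm_group.axioms(2)[OF assms(2)] assms(3,1)] assms
      bij_betw_same_card[of \<phi> "carrier G" "carrier H"]
    unfolding order_exponent_def by (auto simp: order_def iso_def)
qed

lemma DirProd_nat_pow:
  "(x, y) [^]\<^bsub>G \<times>\<times> H\<^esub> (d::nat) = (x [^]\<^bsub>G\<^esub> d, y [^]\<^bsub>H\<^esub> d)"
  by (induction d) auto

lemma order_exponent_DirProd:
  assumes "order_exponent G t c" "order_exponent H t' c'"
  shows "order_exponent (G \<times>\<times> H) (t * t') (lcm c c')"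
proof -
  interpret G: comm_group G using assms by (simp add: order_exponent_def)
  interpret H: comm_group H using assms by (simp add: order_exponent_def)
  interpret GH: group "G \<times>\<times> H" by (rule DirProd_group) unfold_locales
  have "comm_group (G \<times>\<times> H)"
    by (rule GH.group_comm_groupI) (auto simp: G.m_comm H.m_comm)
  moreover have "(\<forall>z\<in>carrier (G \<times>\<times> H). z [^]\<^bsub>G \<times>\<times> H\<^esub> d = \<one>\<^bsub>G \<times>\<times> H\<^esub>)
    \<longleftrightarrow> (\<forall>x\<in>carrier G. x [^]\<^bsub>G\<^esub> d = \<one>\<^bsub>G\<^esub>) \<and> (\<forall>y\<in>carrier H. y [^]\<^bsub>H\<^esub> d = \<one>\<^bsub>H\<^esub>)" for d :: nat
    by (auto simp: DirProd_nat_pow)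
  ultimately show ?thesis
    using assms by (auto simp: order_exponent_def order_def card_cartesian_product)
qed

section \<open>Numerical type of a ring\<close>

lemma Units_RDirProd:
  "Units (RDirProd R S) = Units R \<times> Units S"
  unfolding Units_def RDirProd_def DirProd_def by (auto simp: monoid.defs)

lemma units_of_RDirProd: "units_of (RDirProd R S) = units_of R \<times>\<times> units_of S"
  unfolding units_of_def Units_RDirProd by (auto simp: RDirProd_def DirProd_def monoid.defs)

lemma ring_iso_units:
  assumes "ring R" "ring S" "f \<in> ring_iso R S"
  shows "f \<in> iso (units_of R) (units_of S)"
proof -
  interpret R: ring R by fact
  interpret S: ring S by fact
  note f = ring_iso_memE[OF assms(3)]
  have inj: "inj_on f (carrier R)" and im: "f ` carrier R = carrier S"
    using f(5) by (auto simp: bij_betw_def)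
  have U: "f x \<in> Units S \<longleftrightarrow> x \<in> Units R" if x: "x \<in> carrier R" for x
  proof -
    have "f x \<otimes>\<^bsub>S\<^esub> f y = \<one>\<^bsub>S\<^esub> \<longleftrightarrow> x \<otimes>\<^bsub>R\<^esub> y = \<one>\<^bsub>R\<^esub>"
         "f y \<otimes>\<^bsub>S\<^esub> f x = \<one>\<^bsub>S\<^esub> \<longleftrightarrow> y \<otimes>\<^bsub>R\<^esub> x = \<one>\<^bsub>R\<^esub>" if "y \<in> carrier R" for y
      using inj_onD[OF inj, of "x \<otimes>\<^bsub>R\<^esub> y" "\<one>\<^bsub>R\<^esub>"] inj_onD[OF inj, of "y \<otimes>\<^bsub>R\<^esub> x" "\<one>\<^bsub>R\<^esub>"] x that
      by (auto simp flip: f(2,4))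
    thus ?thesis using x f(1)
      unfolding Units_def by (auto simp flip: im)
  qed
  have "f ` Units R = Units S"
    using U R.Units_closed S.Units_closed im by (auto simp: image_iff) (metis imageE)
  moreover have "inj_on f (Units R)"
    using inj by (rule inj_on_subset) auto
  ultimately show ?thesis
    using f(2) by (auto simp: iso_def hom_def bij_betw_def units_of_def)
qed

lemma ring_iso_add_monoid:
  assumes "f \<in> ring_iso R S"
  shows "f \<in> iso (add_monoid R) (add_monoid S)"
  using ring_iso_memE[OF assms] by (auto simp: iso_def hom_def)

text \<open>The first pair of numbers belongs to the additive group, the second pair to the unit group.
  Both are kept together because the construction of the next ring reads off the second pair, which
  then becomes the first pair of that ring.\<close>
definition ring_type :: "('a, 'b) ring_scheme \<Rightarrow> nat \<Rightarrow> nat \<Rightarrow> nat \<Rightarrow> nat \<Rightarrow> bool" where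
  "ring_type R t c t' c' \<longleftrightarrow> ring R \<and> order_exponent (add_monoid R) t c \<and> order_exponent (units_of R) t' c'"

lemma ring_type_iso:
  assumes "f \<in> ring_iso R S" "ring S" "ring_type R t c t' c'"
  shows "ring_type S t c t' c'"
proof -
  interpret R: ring R using assms by (simp add: ring_type_def)
  interpret S: ring S by fact
  show ?thesis
    using assms order_exponent_iso[OF ring_iso_add_monoid[OF assms(1)], of t c]
      order_exponent_iso[OF ring_iso_units[OF R.ring_axioms assms(2,1)], of t' c']
      S.units_group S.a_group
    unfolding ring_type_def by (auto simp: order_exponent_def)
qed

lemma ring_type_RDirProd:
  assumes "ring_type R t c t' c'" "ring_type S u e u' e'"
  shows "ring_type (RDirProd R S) (t * u) (lcm c e) (t' * u') (lcm c' e')"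
  using assms unfolding ring_type_def units_of_RDirProd RDirProd_add_monoid
  by (intro conjI RDirProd_ring order_exponent_DirProd) auto

section \<open>The rings of integers modulo n and their products\<close>

text \<open>The canonical projection from the integers; computing with it avoids all work with cosets.\<close>
definition residue :: "nat \<Rightarrow> int \<Rightarrow> int set" where
  "residue n a = ZMod (int n) a"

lemma residue_eq_iff: "residue n a = residue n b \<longleftrightarrow> [a = b] (mod int n)"
  by (simp add: residue_def ZMod_eq_mod cong_def)

lemma carrier_ZFact: "carrier (ZFact (int n)) = range (residue n)"
  by (auto simp: residue_def ZFact_defs A_RCOSETS_def' ZMod_def)

lemma residue_ring_hom: "ring_hom_ring \<Z> (ZFact (int n)) (residue n)"
proof -
  interpret I: ideal "Idl\<^bsub>\<Z>\<^esub> {int n}" \<Z>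
    by (rule int.genideal_ideal) fast
  show ?thesis
    using I.rcos_ring_hom_ring unfolding ZFact_def residue_def ZMod_def[abs_def] by simp
qed

lemma residue_simps:
  "residue n a \<oplus>\<^bsub>ZFact (int n)\<^esub> residue n b = residue n (a + b)"
  "residue n a \<otimes>\<^bsub>ZFact (int n)\<^esub> residue n b = residue n (a * b)"
  "\<zero>\<^bsub>ZFact (int n)\<^esub> = residue n 0" "\<one>\<^bsub>ZFact (int n)\<^esub> = residue n 1"
proof -
  interpret h: ring_hom_ring \<Z> "ZFact (int n)" "residue n" by (rule residue_ring_hom)
  show "residue n a \<oplus>\<^bsub>ZFact (int n)\<^esub> residue n b = residue n (a + b)"
  "residue n a \<otimes>\<^bsub>ZFact (int n)\<^esub> residue n b = residue n (a * b)"
  "\<zero>\<^bsub>ZFact (int n)\<^esub> = residue n 0" "\<one>\<^bsub>ZFact (int n)\<^esub> = residue n 1"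
    using h.hom_add[of a b] h.hom_mult[of a b] h.hom_zero h.hom_one by simp_all
qed

lemma residue_pow: "residue n a [^]\<^bsub>ZFact (int n)\<^esub> (d::nat) = residue n (a ^ d)"
  by (induction d) (auto simp: residue_simps mult.commute)

lemma residue_add_pow: "residue n a [^]\<^bsub>add_monoid (ZFact (int n))\<^esub> (d::nat) = residue n (int d * a)"
  by (induction d) (auto simp: residue_simps algebra_simps)

lemma residue_Units: "residue n a \<in> Units (ZFact (int n)) \<longleftrightarrow> coprime a (int n)"
proof -
  have "residue n a \<in> Units (ZFact (int n)) \<longleftrightarrow> (\<exists>b. [a * b = 1] (mod int n))"
    by (auto simp: Units_def carrier_ZFact residue_simps residue_eq_iff mult.commute)
  thus ?thesis by (simp add: coprime_iff_invertible_int)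
qed

text \<open>The exponent of the unit group is Carmichael's function by its very meaning: all units are
  killed by it, and some unit has it as its order.\<close>
lemma ring_type_ZFact:
  assumes "n > 0"
  shows "ring_type (ZFact (int n)) n n (totient n) (Carmichael n)"
proof -
  interpret Z: cring "ZFact (int n)" by (rule ZFact_is_cring)
  \<comment> \<open>The representatives 1, ..., n (not 0, ..., n - 1) are those from which the totatives are
    chosen; they also cover n = 1, where 1 is a totative.\<close>
  have inj: "inj_on (\<lambda>k. residue n (int k)) {1..n}"
  proof (rule inj_onI)
    fix x y assume *: "x \<in> {1..n}" "y \<in> {1..n}" "residue n (int x) = residue n (int y)"
    hence "int n dvd int x - int y"
      by (simp add: residue_eq_iff cong_iff_dvd_diff)
    from zdvd_imp_le[of "int n" "\<bar>int x - int y\<bar>"] this * show "x = y" by force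
  qed
  have repr: "\<exists>k\<in>{1..n}. residue n a = residue n (int k)" for a
  proof -
    define k where "k = (if a mod int n = 0 then n else nat (a mod int n))"
    have "k \<in> {1..n}" using assms pos_mod_sign[of "int n" a] pos_mod_bound[of "int n" a]
      by (auto simp: k_def nat_le_iff) (simp_all add: nat_le_iff le_less Suc_leI)
    moreover have "residue n a = residue n (int k)"
      using assms by (auto simp: k_def residue_eq_iff cong_def)
    ultimately show ?thesis by blast
  qed
  have carr: "carrier (ZFact (int n)) = (\<lambda>k. residue n (int k)) ` {1..n}"
    using repr by (auto simp: carrier_ZFact)
  have "order (add_monoid (ZFact (int n))) = n"
    using card_image[OF inj] by (simp add: order_def carr)
  moreover have "(\<forall>x\<in>carrier (ZFact (int n)). x [^]\<^bsub>add_monoid (ZFact (int n))\<^esub> d = \<zero>\<^bsub>ZFact (int n)\<^esub>) \<longleftrightarrow> n dvd d"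
    for d :: nat
  proof
    assume "\<forall>x\<in>carrier (ZFact (int n)). x [^]\<^bsub>add_monoid (ZFact (int n))\<^esub> d = \<zero>\<^bsub>ZFact (int n)\<^esub>"
    hence "residue n 1 [^]\<^bsub>add_monoid (ZFact (int n))\<^esub> d = \<zero>\<^bsub>ZFact (int n)\<^esub>"
      by (auto simp: carrier_ZFact)
    thus "n dvd d" unfolding residue_add_pow by (simp add: residue_simps residue_eq_iff cong_0_iff)
  next
    assume "n dvd d"
    thus "\<forall>x\<in>carrier (ZFact (int n)). x [^]\<^bsub>add_monoid (ZFact (int n))\<^esub> d = \<zero>\<^bsub>ZFact (int n)\<^esub>"
      unfolding carrier_ZFact[of n] ball_simps image_iff
      using residue_add_pow[of n _ d, unfolded carrier_ZFact]
      by (auto simp: residue_simps residue_eq_iff cong_0_iff)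
  qed
  moreover have "Units (ZFact (int n)) = (\<lambda>k. residue n (int k)) ` totatives n"
  proof (intro equalityI subsetI)
    fix x assume x: "x \<in> Units (ZFact (int n))"
    then obtain k where "x = residue n (int k)" "k \<in> {1..n}"
      using Z.Units_closed carr by blast
    thus "x \<in> (\<lambda>k. residue n (int k)) ` totatives n"
      using x by (auto simp: residue_Units totatives_def)
  qed (auto simp: residue_Units totatives_def)
  moreover have "card ((\<lambda>k. residue n (int k)) ` totatives n) = totient n"
    using inj by (subst card_image) (auto simp: totient_def totatives_def intro: inj_on_subset)
  moreover have "(\<forall>x\<in>Units (ZFact (int n)). x [^]\<^bsub>ZFact (int n)\<^esub> d = \<one>\<^bsub>ZFact (int n)\<^esub>) \<longleftrightarrow> Carmichael n dvd d"
    for d :: nat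
  proof
    assume *: "\<forall>x\<in>Units (ZFact (int n)). x [^]\<^bsub>ZFact (int n)\<^esub> d = \<one>\<^bsub>ZFact (int n)\<^esub>"
    obtain g where g: "g \<in> totatives n" "ord n g = Carmichael n"
      using Carmichael_root_exists[OF assms] .
    hence "residue n (int g) \<in> Units (ZFact (int n))"
      by (auto simp: residue_Units totatives_def)
    hence "[int g ^ d = 1] (mod int n)"
      using * by (auto simp: residue_pow residue_simps residue_eq_iff)
    hence "[g ^ d = 1] (mod n)"
      by (metis cong_int_iff of_nat_1 of_nat_power)
    thus "Carmichael n dvd d"
      using g by (metis ord_divides)
  next
    assume *: "Carmichael n dvd d"
    show "\<forall>x\<in>Units (ZFact (int n)). x [^]\<^bsub>ZFact (int n)\<^esub> d = \<one>\<^bsub>ZFact (int n)\<^esub>"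
    proof
      fix x assume x: "x \<in> Units (ZFact (int n))"
      then obtain k where k: "x = residue n (int k)"
        using Z.Units_closed carr by blast
      hence "coprime n k" using x by (simp add: residue_Units coprime_commute)
      hence "[k ^ d = 1] (mod n)" using * by (intro Carmichael_divides)
      hence "[int k ^ d = 1] (mod int n)"
        by (metis cong_int_iff of_nat_1 of_nat_power)
      thus "x [^]\<^bsub>ZFact (int n)\<^esub> d = \<one>\<^bsub>ZFact (int n)\<^esub>"
        by (simp add: k residue_pow residue_simps residue_eq_iff)
    qed
  qed
  ultimately show ?thesis
    using Z.ring_axioms Z.a_comm_group Z.units_comm_group Z.units_of_pow
    by (simp add: ring_type_def order_exponent_def order_def units_of_carrier units_of_one)
qed

lemma ZFact_prod_Cons:
  "ZFact_prod (n # ns) = image_ring (\<lambda>(a, as). a # as) (RDirProd (ZFact (int n)) (ZFact_prod ns))"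
  by (simp add: ZFact_prod_def RDirProd_list_def)

lemma ZFact_prod_Cons_iso:
  "(\<lambda>(a, as). a # as) \<in> ring_iso (RDirProd (ZFact (int n)) (ZFact_prod ns)) (ZFact_prod (n # ns))"
  unfolding ZFact_prod_Cons by (rule inj_imp_image_ring_iso) (auto simp: inj_on_def)

lemma ring_type_ZFact_prod:
  assumes "\<forall>n\<in>set ns. n \<ge> 1"
  shows "ring_type (ZFact_prod ns) (prod_list ns) (Lcm (set ns))
           (prod_list (map totient ns)) (Lcm (Carmichael ` set ns))"
  using assms
proof (induction ns)
  case Nil
  have r: "ring (nil_ring :: int set list ring)"
    by (rule ringI, rule abelian_groupI, auto simp: monoid.defs intro!: monoidI)
  then interpret ring "nil_ring :: int set list ring" .
  have "comm_group (add_monoid (nil_ring :: int set list ring))"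
    by (rule a_comm_group)
  moreover have "comm_group (units_of (nil_ring :: int set list ring))"
    by (rule group.group_comm_groupI[OF units_group]) (auto simp: units_of_def monoid.defs)
  moreover have "x [^]\<^bsub>add_monoid nil_ring\<^esub> d = []" "x [^]\<^bsub>units_of nil_ring\<^esub> d = []" for d :: nat and x :: "int set list"
    by (induction d) (auto simp: units_of_def monoid.defs)
  moreover have "Units (nil_ring :: int set list ring) = {[]}"
    by (auto simp: Units_def monoid.defs)
  ultimately show ?case using r
    by (simp add: ring_type_def order_exponent_def ZFact_prod_def order_def units_of_def)
      (simp add: monoid.defs)
next
  case (Cons n ns)
  have P: "ring_type (RDirProd (ZFact (int n)) (ZFact_prod ns)) (n * prod_list ns) (lcm n (Lcm (set ns)))
      (totient n * prod_list (map totient ns)) (lcm (Carmichael n) (Lcm (Carmichael ` set ns)))"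
    using Cons by (intro ring_type_RDirProd ring_type_ZFact) auto
  then interpret P: ring "RDirProd (ZFact (int n)) (ZFact_prod ns)" by (simp add: ring_type_def)
  have "ring (ZFact_prod (n # ns))"
    unfolding ZFact_prod_Cons by (rule P.inj_imp_image_ring_is_ring) (auto simp: inj_on_def)
  from ring_type_iso[OF ZFact_prod_Cons_iso this P] show ?case by simp
qed

section \<open>Boolean rings\<close>

definition idempotents_only :: "('a, 'b) ring_scheme \<Rightarrow> bool" where
  "idempotents_only R \<longleftrightarrow> (\<forall>x\<in>carrier R. x \<otimes>\<^bsub>R\<^esub> x = x)"

lemma idempotents_only_iso:
  assumes "f \<in> ring_iso R S" "ring R"
  shows "idempotents_only R \<longleftrightarrow> idempotents_only S"
proof -
  interpret R: ring R by fact
  note f = ring_iso_memE[OF assms(1)]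
  have inj: "inj_on f (carrier R)" and im: "f ` carrier R = carrier S"
    using f(5) by (auto simp: bij_betw_def)
  have "f x \<otimes>\<^bsub>S\<^esub> f x = f x \<longleftrightarrow> x \<otimes>\<^bsub>R\<^esub> x = x" if "x \<in> carrier R" for x
    using inj_onD[OF inj, of "x \<otimes>\<^bsub>R\<^esub> x" x] that by (auto simp flip: f(2))
  thus ?thesis by (auto simp: idempotents_only_def simp flip: im)
qed

lemma idempotents_only_RDirProd:
  assumes "ring R" "ring S"
  shows "idempotents_only (RDirProd R S) \<longleftrightarrow> idempotents_only R \<and> idempotents_only S"
  using ring.ring_simprules(2)[OF assms(1)] ring.ring_simprules(2)[OF assms(2)]
  by (auto simp: idempotents_only_def RDirProd_def DirProd_def monoid.defs)

lemma idempotents_only_ZFact: "idempotents_only (ZFact (int n)) \<longleftrightarrow> n dvd 2"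
proof
  assume "idempotents_only (ZFact (int n))"
  hence "[a * a = a] (mod int n)" for a
    by (auto simp: idempotents_only_def carrier_ZFact residue_simps residue_eq_iff)
  from this[of 2] have "int n dvd 2" by (simp add: cong_iff_dvd_diff)
  thus "n dvd 2" by (metis int_dvd_int_iff of_nat_numeral)
next
  assume "n dvd 2"
  hence n: "int n dvd 2" by (metis int_dvd_int_iff of_nat_numeral)
  have "[a * a = a] (mod int n)" for a :: int
  proof -
    have "2 dvd a * a - a" by simp
    thus ?thesis using dvd_trans[OF n] by (simp add: cong_iff_dvd_diff)
  qed
  thus "idempotents_only (ZFact (int n))"
    by (auto simp: idempotents_only_def carrier_ZFact residue_simps residue_eq_iff)
qed

text \<open>A product of residue rings is idempotent exactly if each factor is, that is, if each factor
  has characteristic 1 or 2. Hence this law can be read off the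
  additive exponent.\<close>
lemma idempotents_only_ZFact_prod:
  assumes "\<forall>n\<in>set ns. n \<ge> 1"
  shows "idempotents_only (ZFact_prod ns) \<longleftrightarrow> Lcm (set ns) dvd 2"
  using assms
proof (induction ns)
  case Nil
  show ?case by (simp add: idempotents_only_def ZFact_prod_def) (simp add: monoid.defs)
next
  case (Cons n ns)
  have r: "ring (ZFact (int n))" "ring (ZFact_prod ns)"
    using ring_type_ZFact[of n] ring_type_ZFact_prod[of ns] Cons.prems by (auto simp: ring_type_def)
  show ?case
    using idempotents_only_iso[OF ZFact_prod_Cons_iso RDirProd_ring[OF r]]
      idempotents_only_RDirProd[OF r] Cons by (auto simp: idempotents_only_ZFact)
qed

section \<open>The ring structure on the unit group\<close>

lemma order_exponent_unique:
  assumes "order_exponent G t c" "order_exponent G t' c'"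
  shows "t = t'" "c = c'"
  using assms dvd_antisym[of c c'] unfolding order_exponent_def by (metis dvd_refl)+

text \<open>The decomposition into cyclic groups is an arbitrary one. Its moduli are nevertheless bound
  by two equations, since order and exponent of the unit group do not depend on the choice.\<close>
lemma units_ring_type:
  assumes "order_exponent (units_of R) t c" "cyclic_decomp (units_of R) d"
  obtains ns where "\<forall>n\<in>set ns. n \<ge> 1" "prod_list ns = t" "Lcm (set ns) = c"
    "ring_type (units_ring R) t c (prod_list (map totient ns)) (Lcm (Carmichael ` set ns))"
    "idempotents_only (units_ring R) \<longleftrightarrow> c dvd 2"
proof -
  obtain ns \<phi> where some: "(SOME d. cyclic_decomp (units_of R) d) = (ns, \<phi>)"
    by (cases "SOME d. cyclic_decomp (units_of R) d")
  hence "cyclic_decomp (units_of R) (ns, \<phi>)"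
    using someI[of "cyclic_decomp (units_of R)", OF assms(2)] by simp
  hence ns: "\<forall>n\<in>set ns. n \<ge> 1" and \<phi>: "\<phi> \<in> iso (add_monoid (ZFact_prod ns)) (units_of R)"
    by (auto simp: cyclic_decomp_def)
  note type = ring_type_ZFact_prod[OF ns]
  then interpret Z: ring "ZFact_prod ns" by (simp add: ring_type_def)
  have "group (units_of R)"
    using assms(1) by (auto simp: order_exponent_def comm_group_def)
  hence "order_exponent (units_of R) (prod_list ns) (Lcm (set ns))"
    using order_exponent_iso[OF \<phi> Z.a_comm_group] type by (simp add: ring_type_def)
  note eq = order_exponent_unique[OF this assms(1)]
  have inj: "inj_on \<phi> (carrier (ZFact_prod ns))"
    using \<phi> by (auto simp: iso_def bij_betw_def)
  have R: "units_ring R = image_ring \<phi> (ZFact_prod ns)"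
    by (simp add: units_ring_def some)
  note iso = inj_imp_image_ring_iso[OF inj] and ring = Z.inj_imp_image_ring_is_ring[OF inj]
  show ?thesis
    using that[OF ns] eq ring_type_iso[OF iso ring type] idempotents_only_iso[OF iso Z.ring_axioms]
      idempotents_only_ZFact_prod[OF ns] by (simp add: R)
qed

lemma boolean_ring_iff:
  assumes "ring_type R t c t' c'"
  shows "boolean_ring R \<longleftrightarrow> t \<noteq> 1 \<and> idempotents_only R"
proof -
  interpret ring R using assms by (simp add: ring_type_def)
  have "card (carrier R) = t"
    using assms by (simp add: ring_type_def order_exponent_def order_def)
  thus ?thesis
    using ring_axioms by (auto simp: boolean_ring_def idempotents_only_def numeral_2_eq_2)
qed

lemma trivial_ring_iff:
  assumes "ring_type R t c t' c'"
  shows "trivial_ring R \<longleftrightarrow> t = 1"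
  using assms by (simp add: trivial_ring_def ring_type_def order_exponent_def order_def)

section \<open>Unit groups of order two times a prime power\<close>

lemma prime_power_dvd_Lcm:
  fixes p :: nat
  assumes "Factorial_Ring.prime p" "finite A" "A \<noteq> {}" "0 \<notin> A" "p ^ b dvd Lcm A"
  shows "\<exists>n\<in>A. p ^ b dvd n"
  using assms(2-)
proof (induction A rule: finite_ne_induct)
  case (insert n A)
  have nz: "n \<noteq> 0" "Lcm A \<noteq> 0" using insert by (auto simp: Lcm_0_iff)
  have "b \<le> multiplicity p (lcm n (Lcm A))"
    using insert.prems nz assms(1) by (subst (asm) power_dvd_iff_le_multiplicity) (auto simp: lcm_eq_0_iff)
  also have "\<dots> = max (multiplicity p n) (multiplicity p (Lcm A))"
    using nz assms(1) by (intro multiplicity_lcm) auto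
  finally have "p ^ b dvd n \<or> p ^ b dvd Lcm A"
    by (auto simp: le_max_iff_disj multiplicity_dvd')
  thus ?case using insert by auto
qed auto

text \<open>This replaces the uniqueness of the decomposition into cyclic groups for
  \<open>\<int>\<^sub>2 \<times> \<int>\<^bsub>p^b\<^esub>\<close>. Since p^b divides the exponent, it divides one of the moduli, say n.
  The order leaves only a factor 2, which sits either in the other moduli or in n. Moduli 1 and 2
  have trivial unit groups. If n is 2 p^b, then p is odd (and the factor 2 of the modulus is invisible
  in the unit group) or n is 2: for p = 2 and b > 0 the exponent is too small for 2^(b+1).\<close>
lemma totient_Carmichael_prime_power_of_factors:
  fixes p :: nat
  assumes p: "Factorial_Ring.prime p" and ns: "\<forall>n\<in>set ns. n \<ge> 1"
    and prod: "prod_list ns = 2 * p ^ b" and Lcm: "Lcm (set ns) = lcm 2 (p ^ b)"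
  shows "prod_list (map totient ns) = totient (p ^ b)" "Lcm (Carmichael ` set ns) = Carmichael (p ^ b)"
proof -
  have "0 \<notin> set ns" using ns by auto
  moreover have "p ^ b dvd Lcm (set ns)" by (simp add: Lcm)
  moreover have "ns \<noteq> []" using prod prime_gt_0_nat[OF p] by auto
  ultimately obtain n where n: "n \<in> set ns" "p ^ b dvd n"
    using prime_power_dvd_Lcm[OF p, of "set ns" b] by auto
  obtain xs ys where split: "ns = xs @ n # ys"
    using split_list[OF n(1)] by blast
  define r where "r = prod_list (xs @ ys)"
  obtain q where q: "n = p ^ b * q" using n(2) by blast
  have qr: "q * r = 2"
    using prod prime_gt_0_nat[OF p] by (auto simp: split q r_def mult_ac)
  have small: "m = 1 \<or> m = 2" if "m \<in> set (xs @ ys)" for m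
  proof -
    have "m dvd r" unfolding r_def using that by (rule prod_list_dvd)
    hence "m dvd 2" using qr by (metis dvd_mult)
    thus ?thesis using prime_nat_iff two_is_prime_nat by blast
  qed
  hence tot: "totient m = 1" and car: "Carmichael m = 1" if "m \<in> set (xs @ ys)" for m
    using that by force+
  have main: "totient n = totient (p ^ b) \<and> Carmichael n = Carmichael (p ^ b)"
  proof (cases "q = 1")
    case True
    thus ?thesis by (simp add: q)
  next
    case False
    have "q dvd 2" using qr by (metis dvd_triv_left)
    hence "q = 2" using False prime_nat_iff two_is_prime_nat by blast
    show ?thesis
    proof (cases "p = 2")
      case True
      have "n dvd Lcm (set ns)" using n(1) by (rule dvd_Lcm)
      hence "2 ^ Suc b dvd lcm 2 (2 ^ b :: nat)" using True \<open>q = 2\<close> by (simp add: Lcm q mult.commute)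
      hence "b = 0" 
        by (cases b) (auto simp: lcm_proj2_if_dvd_nat dest: dvd_imp_le)
      thus ?thesis by (simp add: q \<open>q = 2\<close>)
    next
      case False
      hence "coprime (p ^ b) 2" using p primes_dvd_imp_eq[OF two_is_prime_nat p] by auto
      thus ?thesis
        by (simp add: q \<open>q = 2\<close> totient_mult_coprime Carmichael_mult_coprime)
    qed
  qed
  have "map totient xs = map (\<lambda>_. 1) xs" "map totient ys = map (\<lambda>_. 1) ys"
    using tot by auto
  hence "prod_list (map totient xs) = 1" "prod_list (map totient ys) = 1"
    by (simp_all add: map_replicate_const)
  thus "prod_list (map totient ns) = totient (p ^ b)"
    using main by (simp add: split)
  have "Carmichael ` set (xs @ ys) \<subseteq> {1}" using car by auto
  hence "Lcm (Carmichael ` set (xs @ ys)) = 1"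
    by (intro dvd_antisym Lcm_least) auto
  moreover have "Carmichael ` set ns = insert (Carmichael n) (Carmichael ` set (xs @ ys))"
    by (auto simp: split)
  ultimately show "Lcm (Carmichael ` set ns) = Carmichael (p ^ b)"
    using main by simp
qed

section \<open>Existence of a cyclic decomposition\<close>

lemma ZFact_prod_pair:
  "carrier (ZFact_prod [m, n]) = {[residue m a, residue n b] | a b. True}"
  "[residue m a, residue n b] \<oplus>\<^bsub>ZFact_prod [m, n]\<^esub> [residue m a', residue n b']
     = [residue m (a + a'), residue n (b + b')]"
  "\<zero>\<^bsub>ZFact_prod [m, n]\<^esub> = [residue m 0, residue n 0]"
proof -
  have nil: "carrier (ZFact_prod []) = {[]}" "[] \<oplus>\<^bsub>ZFact_prod []\<^esub> [] = []" "\<zero>\<^bsub>ZFact_prod []\<^esub> = []"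
    by (simp_all add: ZFact_prod_def) (simp_all add: monoid.defs)
  show carr: "carrier (ZFact_prod [m, n]) = {[residue m a, residue n b] | a b. True}"
    by (auto simp: ZFact_prod_Cons image_ring_carrier RDirProd_carrier carrier_ZFact nil)
  have add: "(x # xs) \<oplus>\<^bsub>ZFact_prod (k # ks)\<^esub> (y # ys) = (x \<oplus>\<^bsub>ZFact (int k)\<^esub> y) # (xs \<oplus>\<^bsub>ZFact_prod ks\<^esub> ys)"
    if "x \<in> carrier (ZFact (int k))" "y \<in> carrier (ZFact (int k))"
       "xs \<in> carrier (ZFact_prod ks)" "ys \<in> carrier (ZFact_prod ks)" for x y xs ys k ks
    using ring_iso_memE(3)[OF ZFact_prod_Cons_iso[of k ks], of "(x, xs)" "(y, ys)"] that
    by (simp add: RDirProd_def DirProd_def monoid.defs)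
  show "[residue m a, residue n b] \<oplus>\<^bsub>ZFact_prod [m, n]\<^esub> [residue m a', residue n b']
     = [residue m (a + a'), residue n (b + b')]"
    by (subst add; (subst add)?)
       (auto simp: nil carrier_ZFact residue_simps ZFact_prod_Cons[of n] image_ring_carrier RDirProd_carrier)
  show "\<zero>\<^bsub>ZFact_prod [m, n]\<^esub> = [residue m 0, residue n 0]"
    by (simp add: ZFact_prod_Cons image_ring_zero RDirProd_def DirProd_def monoid.defs nil residue_simps)
qed

text \<open>The map sending the pair of residues of (a, b) to \<open>h^a g^b\<close> is well defined by the orders of h
  and g, injective by independence, and surjective by counting.\<close>
lemma (in comm_group) cyclic_decomp_two_generators:
  fixes m n :: nat
  assumes gens: "h \<in> carrier G" "g \<in> carrier G" and n: "n > 0"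
    and h: "h \<otimes> h = \<one>" and g: "g [^] n = \<one>"
    and indep: "\<And>(a::int) (b::int). h [^] a \<otimes> g [^] b = \<one> \<Longrightarrow> even a \<and> int n dvd b"
    and order: "order G = 2 * n"
  shows "\<exists>d. cyclic_decomp G d"
proof -
  \<comment> \<open>Some integer representative of a residue class; powers of an element of order dividing the
    modulus do not depend on which one.\<close>
  define rep :: "nat \<Rightarrow> int set \<Rightarrow> int" where "rep k S = (SOME a. residue k a = S)" for k S
  have rep: "int k dvd rep k (residue k a) - a" for k a
    using someI[of "\<lambda>b. residue k b = residue k a" a]
    by (simp add: rep_def residue_eq_iff cong_iff_dvd_diff)
  have pow_eq: "x [^] rep k (residue k a) = x [^] a"
    if "x \<in> carrier G" "x [^] k = \<one>" for x a k
  proof -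
    obtain q where q: "rep k (residue k a) = a + int k * q"
      using rep[of k a] by (metis dvdE diff_add_cancel add.commute)
    have "x [^] (int k * q) = \<one>"
      using that by (simp flip: int_pow_pow add: int_pow_int)
    thus ?thesis
      using that by (simp add: q int_pow_mult)
  qed
  define \<phi> where "\<phi> xs = h [^] rep 2 (xs ! 0) \<otimes> g [^] rep n (xs ! 1)" for xs
  have h2: "h [^] (2::nat) = \<one>" using h gens by (simp add: numeral_2_eq_2)
  have \<phi>: "\<phi> [residue 2 a, residue n b] = h [^] a \<otimes> g [^] b" for a b
    using pow_eq[OF gens(1) h2] pow_eq[OF gens(2) g] by (simp add: \<phi>_def)
  define A where "A = add_monoid (ZFact_prod [2, n])"
  have type: "ring_type (ZFact_prod [2, n]) (2 * n) (lcm 2 n) (totient n) (Carmichael n)"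
    using ring_type_ZFact_prod[of "[2, n]"] n by simp
  then interpret Z: ring "ZFact_prod [2, n]" by (simp add: ring_type_def)
  interpret A: group A unfolding A_def by (rule Z.a_group)
  interpret \<phi>: group_hom A G \<phi>
  proof (unfold_locales, rule homI)
    show "\<phi> x \<in> carrier G" if "x \<in> carrier A" for x
      using that gens by (auto simp: A_def ZFact_prod_pair \<phi>)
    show "\<phi> (x \<otimes>\<^bsub>A\<^esub> y) = \<phi> x \<otimes> \<phi> y" if "x \<in> carrier A" "y \<in> carrier A" for x y
      using that gens by (auto simp: A_def ZFact_prod_pair \<phi> int_pow_mult m_ac)
  qed
  have inj: "inj_on \<phi> (carrier A)"
  proof (rule \<phi>.trivial_ker_imp_inj, intro equalityI subsetI)
    fix x assume "x \<in> kernel A G \<phi>"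
    then obtain a b where x: "x = [residue 2 a, residue n b]" and "h [^] a \<otimes> g [^] b = \<one>"
      by (auto simp: kernel_def A_def ZFact_prod_pair \<phi>)
    thus "x \<in> {\<one>\<^bsub>A\<^esub>}"
      using indep[of a b] by (simp add: A_def ZFact_prod_pair residue_eq_iff cong_0_iff)
  qed (auto simp: kernel_def)
  have "card (\<phi> ` carrier A) = card (carrier G)"
    using type order card_image[OF inj] by (simp add: ring_type_def order_exponent_def order_def A_def)
  moreover have "finite (carrier G)"
    using order n by (intro card_ge_0_finite) (simp add: order_def)
  ultimately have "\<phi> ` carrier A = carrier G"
    by (intro card_subset_eq) auto
  hence "\<phi> \<in> iso A G"
    using inj \<phi>.homh by (auto simp: iso_def bij_betw_def)
  hence "cyclic_decomp G ([2, n], \<phi>)"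
    using n by (simp add: cyclic_decomp_def A_def)
  thus ?thesis by blast
qed

text \<open>The empty product is used, whose only element is the empty list.\<close>
lemma (in group) cyclic_decomp_order_one:
  assumes "order G = 1"
  shows "\<exists>d. cyclic_decomp G d"
proof -
  have "carrier (ZFact_prod []) = {[]}" 
    by (simp_all add: ZFact_prod_def)
  moreover have "carrier G = {\<one>}"
    using assms one_closed by (metis card_1_singletonE order_def singletonD)
  ultimately have "(\<lambda>_. \<one>) \<in> iso (add_monoid (ZFact_prod [])) G"
    by (auto simp: iso_def hom_def)
  hence "cyclic_decomp G ([], \<lambda>_. \<one>)"
    by (simp add: cyclic_decomp_def)
  thus ?thesis by blast
qed

lemma (in group) ord_eq_prime_power:
  assumes "Factorial_Ring.prime p" "x \<in> carrier G" "x [^] (p ^ b) = \<one>"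
    and "b > 0 \<Longrightarrow> x [^] (p ^ (b - 1)) \<noteq> \<one>"
  shows "ord x = p ^ b"
proof -
  have "ord x dvd p ^ b" using assms by (simp add: pow_eq_id)
  then obtain i where i: "i \<le> b" "ord x = p ^ i"
    using assms(1) by (auto simp: divides_primepow_nat)
  have "i = b"
  proof (rule ccontr)
    assume "i \<noteq> b"
    hence "p ^ i dvd p ^ (b - 1)" using i by (intro le_imp_power_dvd) auto
    thus False using assms i \<open>i \<noteq> b\<close> by (simp add: pow_eq_id)
  qed
  thus ?thesis using i by simp
qed

lemma (in group) involution_int_pow:
  assumes "h \<in> carrier G" "h \<otimes> h = \<one>"
  shows "h [^] (a::int) = (if even a then \<one> else h)"
proof -
  have "h [^] (2::int) = \<one>" using assms int_pow_mult[of h 1 1] by simp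
  hence *: "h [^] (2 * q) = \<one>" for q :: int
    using assms int_pow_pow[of h 2 q] by simp
  show ?thesis
  proof (cases "even a")
    case True
    thus ?thesis using * by auto
  next
    case False
    then obtain q where "a = 2 * q + 1" by (elim oddE)
    thus ?thesis using False * assms by (simp add: int_pow_mult)
  qed
qed

text \<open>A cyclic subgroup of index 2 whose order is the even exponent m splits off. For x outside the
  subgroup, \<open>x^2 = g^i\<close> lies inside; raising this to the power m/2 gives 1, so i is even, and dividing x
  by \<open>g^(i/2)\<close> turns it into an involution.\<close>
lemma (in comm_group) involution_outside_maximal_cyclic:
  assumes g: "g \<in> carrier G" "ord g = m" and m: "even m" "m > 0"
    and order: "order G = 2 * m" and exponent: "\<And>x. x \<in> carrier G \<Longrightarrow> x [^] m = \<one>"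
  shows "\<exists>h\<in>carrier G. h \<otimes> h = \<one> \<and> (\<forall>i::int. h \<noteq> g [^] i)"
proof -
  define H where "H = generate G {g}"
  have H: "H = {g [^] i | i::int. True}" unfolding H_def using generate_pow[OF g(1)] by auto
  have cardH: "card H = m" unfolding H_def using generate_pow_card[OF g(1)] g(2) by simp
  have HG: "H \<subseteq> carrier G" using g by (auto simp: H)
  have fin: "finite (carrier G)"
    using order m by (intro card_ge_0_finite) (simp add: order_def)
  have "card H < card (carrier G)" using order m cardH by (simp add: order_def)
  hence "H \<noteq> carrier G" by auto
  then obtain x where x: "x \<in> carrier G" "x \<notin> H" using HG by blast
  have xH: "card ((\<lambda>y. x \<otimes> y) ` H) = m"
    using HG x cardH by (subst card_image) (auto simp: inj_on_def subset_iff)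
  have "H \<inter> (\<lambda>y. x \<otimes> y) ` H = {}"
  proof (rule ccontr)
    assume "H \<inter> (\<lambda>y. x \<otimes> y) ` H \<noteq> {}"
    then obtain i j :: int where "x \<otimes> g [^] i = g [^] j" by (auto simp: H)
    hence "x = g [^] (j - i)"
      using x g by (simp add: int_pow_diff inv_solve_right)
    thus False using x(2) by (auto simp: H)
  qed
  hence "card (H \<union> (\<lambda>y. x \<otimes> y) ` H) = card (carrier G)"
    using xH cardH order finite_subset[OF HG fin] by (subst card_Un_disjoint) (auto simp: order_def)
  hence "H \<union> (\<lambda>y. x \<otimes> y) ` H = carrier G"
    using HG x fin by (intro card_subset_eq) auto
  moreover have "x \<otimes> x \<notin> (\<lambda>y. x \<otimes> y) ` H"
    using x HG by (auto simp: subset_iff)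
  ultimately have "x \<otimes> x \<in> H" using x by blast
  then obtain i :: int where i: "x \<otimes> x = g [^] i" by (auto simp: H)
  obtain k where k: "m = 2 * k" using m by blast
  have "g [^] (i * int k) = (x \<otimes> x) [^] k"
    using g by (simp add: i int_pow_pow flip: int_pow_int)
  also have "\<dots> = x [^] m"
    using x by (simp add: k mult_2 pow_mult_distrib nat_pow_mult)
  finally have "g [^] (i * int k) = \<one>" using exponent x by simp
  hence "int m dvd i * int k" using g by (simp add: int_pow_eq_id)
  hence "even i" using k m by auto
  then obtain j where j: "i = 2 * j" by blast
  define h where "h = x \<otimes> g [^] (- j)"
  have "h \<otimes> h = (x \<otimes> x) \<otimes> (g [^] (- j) \<otimes> g [^] (- j))"
    using x g by (simp add: h_def m_ac)
  also have "\<dots> = \<one>"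
    using g by (simp add: i j int_pow_mult[symmetric])
  finally have "h \<otimes> h = \<one>" .
  moreover have "h \<noteq> g [^] l" for l :: int
  proof
    assume "h = g [^] l"
    hence "x = g [^] (l + j)" using x g
      by (simp add: h_def int_pow_mult int_pow_neg inv_solve_right')
    thus False using x(2) by (auto simp: H)
  qed
  ultimately show ?thesis using x g by (auto simp: h_def)
qed

text \<open>Only the special case of the structure theorem for finite abelian groups that occurs for powers
  of 2 and 3: order and exponent are those of \<open>\<int>\<^sub>2 \<times> \<int>\<^bsub>p^b\<^esub>\<close>. If p^b is odd, an involution h and an
  element g of order p^b are suitable powers of elements that witness the exponent, and they are
  independent because their orders are coprime. If p^b is even, g is an element of maximal order and h
  an involution outside the subgroup that it generates.\<close>
lemma cyclic_decomp_two_times_prime_power: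
  fixes G (structure)
  assumes prime: "Factorial_Ring.prime (p::nat)" and G: "order_exponent G (2 * p ^ b) (lcm 2 (p ^ b))"
  shows "\<exists>d. cyclic_decomp G d"
proof -
  interpret comm_group G using G by (simp add: order_exponent_def)
  have p0: "p > 0" using prime by (rule prime_gt_0_nat)
  have order: "order G = 2 * p ^ b" using G by (simp add: order_exponent_def)
  have exponent: "(\<forall>x\<in>carrier G. x [^] d = \<one>) \<longleftrightarrow> 2 dvd d \<and> p ^ b dvd d" for d :: nat
    using G by (simp add: order_exponent_def)
  show ?thesis
  proof (cases "p = 2 \<and> b > 0")
    case True
    hence [simp]: "p = 2" and b: "b > 0" by auto
    have e: "x [^] ((2::nat) ^ b) = \<one>" if "x \<in> carrier G" for x
      using exponent[of "2 ^ b"] b that by auto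
    have "\<not> (2::nat) ^ b dvd 2 ^ (b - 1)" using b by (auto dest: power_dvd_imp_le)
    then obtain g where g: "g \<in> carrier G" "g [^] ((2::nat) ^ (b - 1)) \<noteq> \<one>"
      using exponent[of "2 ^ (b - 1)"] by auto
    hence ord: "ord g = 2 ^ b"
      using e by (intro ord_eq_prime_power) auto
    then obtain h where h: "h \<in> carrier G" "h \<otimes> h = \<one>" "\<And>i::int. h \<noteq> g [^] i"
      using involution_outside_maximal_cyclic[OF g(1) ord] b order e by auto
    show ?thesis
    proof (rule cyclic_decomp_two_generators[OF h(1) g(1) _ h(2)])
      fix a c :: int assume eq: "h [^] a \<otimes> g [^] c = \<one>"
      have "even a"
      proof (rule ccontr)
        assume "odd a"
        hence "h = inv (g [^] c)"
          using eq h g by (simp add: involution_int_pow inv_equality)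
        thus False using h(3)[of "- c"] g by (simp add: int_pow_neg)
      qed
      thus "even a \<and> int (2 ^ b) dvd c"
        using eq h g ord by (simp add: involution_int_pow int_pow_eq_id)
    qed (use e g order in auto)
  next
    case False
    hence odd: "odd (p ^ b)" using primes_dvd_imp_eq[OF two_is_prime_nat prime] by auto
    then obtain x where x: "x \<in> carrier G" "x [^] (p ^ b) \<noteq> \<one>"
      using exponent[of "p ^ b"] by auto
    define h where "h = x [^] (p ^ b)"
    have h: "h \<in> carrier G" "h \<noteq> \<one>" using x by (auto simp: h_def)
    have hh: "h \<otimes> h = \<one>"
      using exponent[of "p ^ b + p ^ b"] x by (simp add: h_def nat_pow_mult mult_2)
    obtain g where g: "g \<in> carrier G" "g [^] (p ^ b) = \<one>" "b > 0 \<Longrightarrow> g [^] (p ^ (b - 1)) \<noteq> \<one>"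
    proof (cases "b = 0")
      case True
      thus ?thesis using that[of \<one>] by simp
    next
      case b: False
      have "\<not> p dvd 2"
        using False b prime two_is_prime_nat primes_dvd_imp_eq by blast
      hence "\<not> p ^ b dvd 2 * p ^ (b - 1)"
        using b p0 by (cases b) auto
      then obtain y where y: "y \<in> carrier G" "y [^] (2 * p ^ (b - 1)) \<noteq> \<one>"
        using exponent[of "2 * p ^ (b - 1)"] by auto
      show ?thesis
        using that[of "y [^] (2::nat)"] y exponent[of "2 * p ^ b"] b by (cases b) (simp_all add: nat_pow_pow mult_ac)
    qed
    have ord: "ord g = p ^ b" using g by (intro ord_eq_prime_power prime) auto
    show ?thesis
    proof (rule cyclic_decomp_two_generators[OF h(1) g(1) _ hh g(2) _ order])
      fix a c :: int assume eq: "h [^] a \<otimes> g [^] c = \<one>"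
      \<comment> \<open>The odd power p^b kills g but fixes the involution h.\<close>
      have "even a"
      proof (rule ccontr)
        assume "odd a"
        have "\<one> = (h [^] a \<otimes> g [^] c) [^] int (p ^ b)" by (simp add: eq)
        also have "\<dots> = h [^] (a * int (p ^ b)) \<otimes> g [^] (c * int (p ^ b))"
          using h g by (simp add: int_pow_distrib int_pow_pow)
        also have "g [^] (c * int (p ^ b)) = \<one>"
          using g ord by (simp add: int_pow_eq_id)
        also have "h [^] (a * int (p ^ b)) = h"
          using \<open>odd a\<close> odd h hh by (simp add: involution_int_pow)
        finally show False using h by simp
      qed
      thus "even a \<and> int (p ^ b) dvd c"
        using eq h hh g ord by (simp add: involution_int_pow int_pow_eq_id)
    qed (use p0 in auto)
  qed
qed

section \<open>Iterating the construction for powers of 2 and 3\<close>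

lemma totient_powers: "totient (2 ^ Suc n) = 2 ^ n" "totient (3 ^ Suc n) = 2 * 3 ^ n"
  using totient_prime_power[of 2 "Suc n"] totient_prime_power[of 3 "Suc n"] by simp_all

lemma Carmichael_powers:
  "Carmichael (2 ^ (n + 2)) = (if n = 0 then 2 else 2 ^ n)" "Carmichael (3 ^ Suc n) = 2 * 3 ^ n"
  using Carmichael_odd_prime_power[of 3 "Suc n"] by (simp_all add: Carmichael_twopow del: power_Suc)

text \<open>The numerical shadow of \<open>U(\<int>\<^bsub>2^a\<^esub>) \<cong> \<int>\<^sub>2 \<times> \<int>\<^bsub>2^(a-2)\<^esub>\<close> and
  \<open>U(\<int>\<^bsub>3^a\<^esub>) \<cong> \<int>\<^sub>2 \<times> \<int>\<^bsub>3^(a-1)\<^esub>\<close>. The number s is the loss in the exponent of p. In the trivial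
  cases a = 0 and (for p = 2) a = 1 the truncated difference a - s is 0, so that the same formula for
  the next step stays correct.\<close>
lemma totient_Carmichael_two_or_three_power:
  assumes "(p, s) = (2, 2) \<or> (p, s) = (3::nat, 1::nat)"
  shows "totient (p ^ a) = 1 \<and> Carmichael (p ^ a) = 1 \<and> a - s = 0 \<or>
    totient (p ^ a) = 2 * p ^ (a - s) \<and> Carmichael (p ^ a) = lcm 2 (p ^ (a - s))"
  using assms
proof
  assume ps: "(p, s) = (2, 2)"
  consider "a = 0" | "a = 1" | b where "a = b + 2"
    by (metis One_nat_def add_2_eq_Suc' not0_implies_Suc)
  thus ?thesis
  proof cases
    case 3
    have "lcm 2 (2 ^ b) = (if b = 0 then 2 else 2 ^ b :: nat)"
      by (cases b) (auto simp: lcm_proj2_if_dvd_nat)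
    thus ?thesis using ps 3 totient_powers(1)[of "Suc b"] Carmichael_powers(1)[of b] by simp
  qed (use ps in auto)
next
  assume ps: "(p, s) = (3, 1)"
  show ?thesis
  proof (cases a)
    case (Suc b)
    have "lcm 2 (3 ^ b) = (2 * 3 ^ b :: nat)"
      by (simp add: lcm_coprime)
    thus ?thesis using ps Suc totient_powers(2)[of b] Carmichael_powers(2)[of b] by simp
  qed (use ps in auto)
qed

text \<open>One application of the construction lowers the exponent of p by s: if the unit group of R looks
  numerically like that of \<open>\<int>\<^bsub>p^a\<^esub>\<close>, then the unit group of the ring U(R) looks numerically like that of
  \<open>\<int>\<^bsub>p^(a-s)\<^esub>\<close>.\<close>
lemma units_ring_step:
  assumes "(p, s) = (2, 2) \<or> (p, s) = (3::nat, 1::nat)"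
    and "order_exponent (units_of R) (totient (p ^ a)) (Carmichael (p ^ a))"
  shows "ring_type (units_ring R) (totient (p ^ a)) (Carmichael (p ^ a))
           (totient (p ^ (a - s))) (Carmichael (p ^ (a - s)))"
    and "idempotents_only (units_ring R) \<longleftrightarrow> Carmichael (p ^ a) dvd 2"
proof -
  interpret U: comm_group "units_of R" using assms(2) by (simp add: order_exponent_def)
  have p: "Factorial_Ring.prime p" using assms(1) by auto
  note shape = totient_Carmichael_two_or_three_power[OF assms(1), of a]
  have "\<exists>d. cyclic_decomp (units_of R) d"
    using shape U.cyclic_decomp_order_one cyclic_decomp_two_times_prime_power[OF p, of "units_of R" "a - s"] assms(2)
    by (auto simp: order_exponent_def)
  then obtain d where "cyclic_decomp (units_of R) d" by blast
  from units_ring_type[OF assms(2) this] obtain ns where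
    ns: "\<forall>n\<in>set ns. n \<ge> 1" "prod_list ns = totient (p ^ a)" "Lcm (set ns) = Carmichael (p ^ a)"
    "ring_type (units_ring R) (totient (p ^ a)) (Carmichael (p ^ a))
       (prod_list (map totient ns)) (Lcm (Carmichael ` set ns))"
    "idempotents_only (units_ring R) \<longleftrightarrow> Carmichael (p ^ a) dvd 2" .
  have "prod_list (map totient ns) = totient (p ^ (a - s)) \<and> Lcm (Carmichael ` set ns) = Carmichael (p ^ (a - s))"
    using shape
  proof
    assume *: "totient (p ^ a) = 1 \<and> Carmichael (p ^ a) = 1 \<and> a - s = 0"
    hence "\<forall>n\<in>set ns. n = 1" using ns(3) dvd_Lcm[of _ "set ns"] by auto
    hence "map totient ns = map (\<lambda>_. 1) ns" "Carmichael ` set ns \<subseteq> {1}" by auto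
    hence "prod_list (map totient ns) = 1" "Lcm (Carmichael ` set ns) = 1"
      by (simp_all add: map_replicate_const) (intro dvd_antisym Lcm_least, auto)
    thus ?thesis using * by simp
  qed (use totient_Carmichael_prime_power_of_factors[OF p ns(1)] ns(2,3) in auto)
  thus "ring_type (units_ring R) (totient (p ^ a)) (Carmichael (p ^ a))
           (totient (p ^ (a - s))) (Carmichael (p ^ (a - s)))"
    "idempotents_only (units_ring R) \<longleftrightarrow> Carmichael (p ^ a) dvd 2"
    using ns(4,5) by simp_all
qed

lemma iterated_units_type:
  assumes "(p, s) = (2, 2) \<or> (p, s) = (3::nat, 1::nat)"
  shows "order_exponent (units_of (iterated_units j (ZFact (int (p ^ \<alpha>)))))
           (totient (p ^ (\<alpha> - s * j))) (Carmichael (p ^ (\<alpha> - s * j)))"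
proof (induction j)
  case 0
  show ?case using ring_type_ZFact[of "p ^ \<alpha>"] assms by (auto simp: ring_type_def iterated_units_def)
next
  case (Suc j)
  from units_ring_step(1)[OF assms this] show ?case
    by (simp add: iterated_units_def ring_type_def add.commute)
qed

lemma iterated_units_boolean_trivial:
  fixes \<alpha> :: nat
  assumes "(p, s) = (2, 2) \<or> (p, s) = (3::nat, 1::nat)" and "k \<ge> 1"
  defines "a \<equiv> \<alpha> - s * (k - 1)"
  shows "boolean_ring (iterated_units k (ZFact (int (p ^ \<alpha>))))
      \<longleftrightarrow> totient (p ^ a) \<noteq> 1 \<and> Carmichael (p ^ a) dvd 2"
    and "trivial_ring (iterated_units k (ZFact (int (p ^ \<alpha>)))) \<longleftrightarrow> totient (p ^ a) = 1"
proof -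
  have eq: "iterated_units k (ZFact (int (p ^ \<alpha>))) = units_ring (iterated_units (k - 1) (ZFact (int (p ^ \<alpha>))))"
    using assms(2) by (cases k) (auto simp: iterated_units_def)
  note step = units_ring_step[OF assms(1) iterated_units_type[OF assms(1), of "k - 1" \<alpha>], folded eq a_def]
  show "boolean_ring (iterated_units k (ZFact (int (p ^ \<alpha>))))
      \<longleftrightarrow> totient (p ^ a) \<noteq> 1 \<and> Carmichael (p ^ a) dvd 2"
    using boolean_ring_iff[OF step(1)] step(2) by simp
  show "trivial_ring (iterated_units k (ZFact (int (p ^ \<alpha>)))) \<longleftrightarrow> totient (p ^ a) = 1"
    by (rule trivial_ring_iff[OF step(1)])
qed

text \<open>After k - 1 steps the exponent of p is \<open>\<alpha> - s (k - 1)\<close>. For p = 2 the totient of 2^a is 1 for a at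
  most 1, and Carmichael's function at 2^a divides 2 for a at most 3; for p = 3 the bounds are 0 and 1.\<close>
theorem theorem8:
  fixes \<alpha> k :: nat
  assumes "\<alpha> \<ge> 1" and "k \<ge> 1"
  shows "(boolean_ring (iterated_units k (ZFact (2 ^ \<alpha>))) \<longleftrightarrow> \<alpha> = 2 * k \<or> \<alpha> = 2 * k + 1)
       \<and> (trivial_ring (iterated_units k (ZFact (2 ^ \<alpha>))) \<longleftrightarrow> \<alpha> < 2 * k)
       \<and> (boolean_ring (iterated_units k (ZFact (3 ^ \<alpha>))) \<longleftrightarrow> \<alpha> = k)
       \<and> (trivial_ring (iterated_units k (ZFact (3 ^ \<alpha>))) \<longleftrightarrow> \<alpha> < k)"
proof -
  have two: "totient (2 ^ a) = 1 \<longleftrightarrow> a \<le> 1" for a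
    by (cases a) (auto simp: totient_powers simp del: power_Suc)
  have car2: "Carmichael (2 ^ a) dvd 2 \<longleftrightarrow> a \<le> 3" for a
  proof -
    consider "a = 0" | "a = 1" | b where "a = b + 2"
      by (metis One_nat_def add_2_eq_Suc' not0_implies_Suc)
    thus ?thesis
    proof cases
      case (3 b)
      have "(2::nat) ^ b dvd 2 \<longleftrightarrow> b \<le> 1"
        by (cases b; cases "b - 1") (auto dest: dvd_imp_le)
      thus ?thesis using 3 Carmichael_powers(1)[of b] by simp
    qed auto
  qed
  have three: "totient (3 ^ a) = 1 \<longleftrightarrow> a = 0" for a
    by (cases a) (auto simp: totient_powers simp del: power_Suc)
  have "3 ^ i * (2::nat) dvd 2 \<longleftrightarrow> i = 0" for i
    by (cases i) (auto dest: dvd_imp_le)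
  hence car3: "Carmichael (3 ^ a) dvd 2 \<longleftrightarrow> a \<le> 1" for a
    by (cases a) (auto simp: Carmichael_powers mult.commute simp del: power_Suc)
  note B2 = iterated_units_boolean_trivial[of 2 2 k \<alpha>, unfolded two car2]
  note B3 = iterated_units_boolean_trivial[of 3 1 k \<alpha>, unfolded three car3]
  show ?thesis
    using assms B2 B3 by auto
qed

end
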